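(* Let $k$ and $n$ be positive integers. If $\mathcal{L}$ is a set of $k$-MOLS$(n)$, then $c(G(\mathcal{L})) \leq k+2$.
   Context: A latin square of order $n$ is an $n\times n$ array with entries from a set of $n$ symbols (taken to be $[n]=\{1,\dots,n\}$) such that each symbol occurs exactly once in each row and in each column. Two latin squares $A,B$ of order $n$ are orthogonal if the $n^2$ pairs $(A[i,j],B[i,j])$ are distinct. A set of $k$-MOLS$(n)$ is a set of $k$ pairwise orthogonal latin squares of order $n$ (for $k=1$, a single latin square). The latin square graph $G(\mathcal{L})$ of a set $\mathcal{L}$ of $k$-MOLS$(n)$ is the graph whose $n^2$ vertices are the cells $(i,j)\in[n]\times[n]$, where two distinct cells are adjacent if they share a row, share a column, or contain the same symbol in at least one of the $k$ latin squares. Cops and Robbers on a graph $G$: first the cops choose vertices, then the robber chooses a vertex; thereafter the cops and the robber alternate turns, and on a turn each player moves to an adjacent vertex or stays put. All positions are visible to everyone. The cops win if after finitely many rounds some cop lands on the robber's vertex; otherwise the robber wins. The cop number $c(G)$ is the least number of cops for which the cops have a winning strategy. *)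

theory Defs
  imports "HOL-Library.FuncSet" "HOL-Library.Extended_Nat" "Graph_Theory.Pair_Digraph"
begin

text \<open>
  An array is a function on cells that is extensional outside \<open>[n] \<times> [n]\<close>, so that equality of
  functions is equality of arrays and the cardinality of a set of arrays has its usual meaning.
\<close>

definition cells :: "nat \<Rightarrow> (nat \<times> nat) set" where
  "cells n = {1..n} \<times> {1..n}"

definition latin_square :: "nat \<Rightarrow> (nat \<times> nat \<Rightarrow> nat) \<Rightarrow> bool" where
  "latin_square n A \<longleftrightarrow>
     A \<in> cells n \<rightarrow>\<^sub>E {1..n} \<and>
     (\<forall>i\<in>{1..n}. \<forall>s\<in>{1..n}. \<exists>!j. j \<in> {1..n} \<and> A (i, j) = s) \<and>
     (\<forall>j\<in>{1..n}. \<forall>s\<in>{1..n}. \<exists>!i. i \<in> {1..n} \<and> A (i, j) = s)"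

definition orthogonal_squares ::
  "nat \<Rightarrow> (nat \<times> nat \<Rightarrow> nat) \<Rightarrow> (nat \<times> nat \<Rightarrow> nat) \<Rightarrow> bool" where
  "orthogonal_squares n A B \<longleftrightarrow> inj_on (\<lambda>c. (A c, B c)) (cells n)"

definition MOLS :: "nat \<Rightarrow> nat \<Rightarrow> (nat \<times> nat \<Rightarrow> nat) set \<Rightarrow> bool" where
  "MOLS k n L \<longleftrightarrow>
     finite L \<and> card L = k \<and> (\<forall>A\<in>L. latin_square n A) \<and> pairwise (orthogonal_squares n) L"

definition latin_square_graph ::
  "nat \<Rightarrow> (nat \<times> nat \<Rightarrow> nat) set \<Rightarrow> (nat \<times> nat) pair_pre_digraph" where
  "latin_square_graph n L =
     \<lparr> pverts = cells n,
       parcs = {(u, v). u \<in> cells n \<and> v \<in> cells n \<and> u \<noteq> v \<and>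
                  (fst u = fst v \<or> snd u = snd v \<or> (\<exists>A\<in>L. A u = A v))} \<rparr>"

text \<open>A \<open>pair_graph\<close> is a finite simple undirected graph, encoded as a symmetric loop-free digraph.\<close>

lemma pair_graph_latin_square_graph: "pair_graph (latin_square_graph n L)"
proof
  show "finite (pverts (latin_square_graph n L))"
    by (simp add: latin_square_graph_def cells_def)
  have "parcs (latin_square_graph n L) \<subseteq> cells n \<times> cells n"
    by (auto simp: latin_square_graph_def)
  then show "finite (parcs (latin_square_graph n L))"
    by (rule finite_subset) (simp add: cells_def)
  have "sym (parcs (latin_square_graph n L))"
    by (rule symI) (auto simp: latin_square_graph_def; metis)
  then show "symmetric (with_proj (latin_square_graph n L))"
    by (simp add: symmetric_def arcs_ends_conv)
qed (auto simp: latin_square_graph_def)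

definition game_move :: "'v pair_pre_digraph \<Rightarrow> 'v \<Rightarrow> 'v \<Rightarrow> bool" where
  "game_move G u v \<longleftrightarrow> v = u \<or> (u, v) \<in> parcs G"

text \<open>\<open>r t\<close> is the position of the robber after his initial choice and \<open>t\<close> further turns.\<close>

definition robber_play :: "'v pair_pre_digraph \<Rightarrow> (nat \<Rightarrow> 'v) \<Rightarrow> bool" where
  "robber_play G r \<longleftrightarrow> r 0 \<in> pverts G \<and> (\<forall>t. game_move G (r t) (r (Suc t)))"

text \<open>
  A strategy of the cops maps the list of the robber's positions so far to the list of the
  positions to be taken by the cops; the earlier cop positions are themselves determined by the
  strategy, so this is full information. The empty list gives the initial placement, and
  \<open>cop_positions \<sigma> r t\<close> are the positions after \<open>t\<close> turns of the cops, the last of which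
  responds to \<open>r (t - 1)\<close>.
\<close>

definition cop_positions :: "('v list \<Rightarrow> 'v list) \<Rightarrow> (nat \<Rightarrow> 'v) \<Rightarrow> nat \<Rightarrow> 'v list" where
  "cop_positions \<sigma> r t = \<sigma> (map r [0..<t])"

definition cop_strategy :: "'v pair_pre_digraph \<Rightarrow> nat \<Rightarrow> ('v list \<Rightarrow> 'v list) \<Rightarrow> bool" where
  "cop_strategy G m \<sigma> \<longleftrightarrow>
     length (\<sigma> []) = m \<and> set (\<sigma> []) \<subseteq> pverts G \<and>
     (\<forall>r. robber_play G r \<longrightarrow>
       (\<forall>t. list_all2 (game_move G) (cop_positions \<sigma> r t) (cop_positions \<sigma> r (Suc t))))"

text \<open>
  The robber is caught as soon as he shares a vertex with a cop: either right after his own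
  \<open>t\<close>-th choice (first disjunct) or right after the cops' answer to it (second disjunct).
\<close>

definition robber_caught :: "('v list \<Rightarrow> 'v list) \<Rightarrow> (nat \<Rightarrow> 'v) \<Rightarrow> bool" where
  "robber_caught \<sigma> r \<longleftrightarrow>
     (\<exists>t. r t \<in> set (cop_positions \<sigma> r t) \<or> r t \<in> set (cop_positions \<sigma> r (Suc t)))"

definition cops_win :: "'v pair_pre_digraph \<Rightarrow> nat \<Rightarrow> bool" where
  "cops_win G m \<longleftrightarrow>
     (\<exists>\<sigma>. cop_strategy G m \<sigma> \<and> (\<forall>r. robber_play G r \<longrightarrow> robber_caught \<sigma> r))"

text \<open>The infimum is a minimum, except that it is \<open>\<infinity>\<close> if no finite number of cops suffices.\<close>

definition cop_number :: "'v pair_pre_digraph \<Rightarrow> enat" where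
  "cop_number G = Inf {enat m | m. cops_win G m}"

end

(* Rows, columns and each of the k squares give k + 2 classes of lines, and every move of the robber
   stays on a line through his current cell. Start all cops on the cell (1, 1) and give each of them
   one class. In a single move every cop reaches the line of his class through the robber's initial
   cell. Wherever the robber goes next, he remains on one of these lines, and the cop on it
   captures him. *)

theory Submission
  imports Defs
begin

lemma robber_play_in_verts:
  assumes "\<And>u v. (u, v) \<in> parcs G \<Longrightarrow> v \<in> pverts G" "robber_play G r"
  shows "r t \<in> pverts G"
  using assms by (induction t) (auto simp: robber_play_def game_move_def, metis)

text \<open>A class of lines is encoded as a labelling \<open>f\<close> whose fibres are the lines,
  so two vertices lie on a common line of the class exactly when \<open>f\<close> agrees on them.
  Each entry of \<open>fs\<close> stands for one cop; by \<open>line\<close>, the fibres are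
  cliques.\<close>

lemma cops_win_line_classes:
  fixes fs :: "('v \<Rightarrow> 'a) list"
  assumes c: "c \<in> pverts G"
    and closed: "\<And>u v. (u, v) \<in> parcs G \<Longrightarrow> v \<in> pverts G"
    and step: "\<And>u v. u \<in> pverts G \<Longrightarrow> game_move G u v \<Longrightarrow> \<exists>f\<in>set fs. f u = f v"
    and line: "\<And>f u v. f \<in> set fs \<Longrightarrow> u \<in> pverts G \<Longrightarrow> v \<in> pverts G \<Longrightarrow> f u = f v \<Longrightarrow>
      game_move G u v"
    and reach: "\<And>f u. f \<in> set fs \<Longrightarrow> u \<in> pverts G \<Longrightarrow> \<exists>x. game_move G c x \<and> f x = f u"
  shows "cops_win G (length fs)"
proof -
  obtain x where x: "game_move G c (x f u)" "f (x f u) = f u"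
    if "f \<in> set fs" "u \<in> pverts G" for f u
    using reach by metis
  \<comment> \<open>Here \<open>u\<close> and \<open>v\<close> are the robber's first two positions.
    The last case covers all longer histories too, so the cops stand still after their second turn,
    when the capture has already happened.\<close>
  define \<sigma> where "\<sigma> h = (case h of [] \<Rightarrow> map (\<lambda>f. c) fs
      | [u] \<Rightarrow> map (\<lambda>f. x f u) fs
      | u # v # _ \<Rightarrow> map (\<lambda>f. if f u = f v then v else x f u) fs)" for h
  have play0: "cop_positions \<sigma> r 0 = map (\<lambda>f. c) fs"
    and play1: "cop_positions \<sigma> r (Suc 0) = map (\<lambda>f. x f (r 0)) fs"
    and play2: "cop_positions \<sigma> r (Suc (Suc t)) =
      map (\<lambda>f. if f (r 0) = f (r (Suc 0)) then r (Suc 0) else x f (r 0)) fs" for r t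
    \<comment> \<open>\<open>upt_rec\<close> unfolds the history from the front, where
      \<open>\<sigma>\<close> looks; \<open>upt_Suc\<close> would split off its last entry.\<close>
    by (simp_all add: cop_positions_def \<sigma>_def upt_rec del: upt_Suc)
  have "list_all2 (game_move G) (cop_positions \<sigma> r t) (cop_positions \<sigma> r (Suc t))"
    if r: "robber_play G r" for r t
  proof -
    have verts: "r s \<in> pverts G" for s
      using robber_play_in_verts closed r by metis
    have x_verts: "x f (r 0) \<in> pverts G" if "f \<in> set fs" for f
      using x(1)[OF that verts[of 0]] closed c by (auto simp: game_move_def)
    consider "t = 0" | "t = Suc 0" | s where "t = Suc (Suc s)"
      by (metis not0_implies_Suc)
    then show ?thesis
    proof cases
      case 1
      then show ?thesis
        using x(1) verts by (simp add: play0 play1 list_all2_conv_all_nth)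
    next
      case 2
      \<comment> \<open>A cop leaves \<open>x f (r 0)\<close> only if the robber is still on the
        line of \<open>f\<close> through \<open>r 0\<close>. Both vertices then lie on this line,
        and \<open>line\<close> makes the move legal.\<close>
      have "game_move G (x f (r 0)) (if f (r 0) = f (r (Suc 0)) then r (Suc 0) else x f (r 0))"
        if f: "f \<in> set fs" for f
      proof (cases "f (r 0) = f (r (Suc 0))")
        case True
        then show ?thesis
          using line[OF f x_verts[OF f] verts] x(2)[OF f verts] by simp
      qed (simp add: game_move_def)
      then show ?thesis
        using 2 by (simp add: play1 play2 list_all2_conv_all_nth)
    next
      case 3
      then show ?thesis
        by (simp add: play2 list_all2_conv_all_nth game_move_def)
    qed
  qed
  then have "cop_strategy G (length fs) \<sigma>"
    using c by (auto simp: cop_strategy_def \<sigma>_def)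
  moreover have "robber_caught \<sigma> r" if r: "robber_play G r" for r
  proof -
    \<comment> \<open>The robber's first move, even if he stays put, keeps some label
      \<open>f\<close>; the cop of this \<open>f\<close> captures him on the second turn.\<close>
    obtain f where "f \<in> set fs" "f (r 0) = f (r (Suc 0))"
      using step[of "r 0" "r (Suc 0)"] r by (auto simp: robber_play_def)
    then have "r (Suc 0) \<in> set (cop_positions \<sigma> r (Suc (Suc 0)))"
      by (force simp: play2)
    then show ?thesis
      unfolding robber_caught_def by blast
  qed
  ultimately show ?thesis
    unfolding cops_win_def by blast
qed

lemma cops_win_latin_square_graph:
  assumes "n \<ge> 1" "finite L" "\<And>A. A \<in> L \<Longrightarrow> latin_square n A"
  shows "cops_win (latin_square_graph n L) (card L + 2)"
proof -
  let ?G = "latin_square_graph n L"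
  \<comment> \<open>Distinctness makes the number of labellings exactly
    \<open>card L + 2\<close>.\<close>
  obtain As where As: "set As = L" "distinct As"
    using finite_distinct_list assms(2) by blast
  have move: "game_move ?G u v \<longleftrightarrow>
      u = v \<or> v \<in> cells n \<and> (fst u = fst v \<or> snd u = snd v \<or> (\<exists>A\<in>L. A u = A v))"
    if "u \<in> cells n" for u v
    using that by (auto simp: game_move_def latin_square_graph_def)
  have "cops_win ?G (length (fst # snd # As))"
  proof (rule cops_win_line_classes)
    show "(1, 1) \<in> pverts ?G"
      using assms(1) by (simp add: latin_square_graph_def cells_def)
  next
    fix f u assume f: "f \<in> set (fst # snd # As)" and "u \<in> pverts ?G"
    then have u: "fst u \<in> {1..n}" "snd u \<in> {1..n}" "u \<in> cells n"
      by (auto simp: latin_square_graph_def cells_def)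
    consider "f = fst" | "f = snd" | "f \<in> L"
      using f As by auto
    then show "\<exists>x. game_move ?G (1, 1) x \<and> f x = f u"
    proof cases
      \<comment> \<open>The row of \<open>u\<close> meets column 1, and the column of
        \<open>u\<close> meets row 1, in a cell equal or adjacent to \<open>(1, 1)\<close>.\<close>
      case 1
      then show ?thesis
        using u assms(1) by (intro exI[of _ "(fst u, 1)"]) (simp add: move cells_def)
    next
      case 2
      then show ?thesis
        using u assms(1) by (intro exI[of _ "(1, snd u)"]) (simp add: move cells_def)
    next
      case 3
      then have "latin_square n f"
        by (rule assms(3))
      moreover from this have "f u \<in> {1..n}"
        using u(3) unfolding latin_square_def by (blast dest: PiE_mem)
      \<comment> \<open>Row 1 of the square \<open>f\<close> contains every symbol, in particular
        that of \<open>u\<close>.\<close>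
      ultimately obtain j where "j \<in> {1..n}" "f (1, j) = f u"
        using assms(1) unfolding latin_square_def by (metis atLeastAtMost_iff order_refl)
      then show ?thesis
        using assms(1) by (intro exI[of _ "(1, j)"]) (simp add: move cells_def)
    qed
  \<comment> \<open>For a robber who stays put, any labelling, such as \<open>fst\<close>, is a
    witness for \<open>step\<close>.\<close>
  qed (auto simp: move As latin_square_graph_def game_move_def)
  then show ?thesis
    using As distinct_card by fastforce
qed

theorem theorem2p1:
  fixes k n :: nat and L :: "(nat \<times> nat \<Rightarrow> nat) set"
  assumes "k \<ge> 1" and "n \<ge> 1"
    and "MOLS k n L"
  shows "cop_number (latin_square_graph n L) \<le> enat (k + 2)"
proof -
  have "cops_win (latin_square_graph n L) (k + 2)"
    using cops_win_latin_square_graph assms(2,3) unfolding MOLS_def by blast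
  then show ?thesis
    unfolding cop_number_def by (intro Inf_lower) blast
qed

end
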